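(* Let $n\ge 2$ and $m\in\mathbb N$. (a) For any sequence $\boldsymbol{\omega}_1,\boldsymbol{\omega}_2,\ldots\in\mathbb R_{>0}^{m+n}$ of weight vectors and any sequence $f_1,f_2,\ldots$ of positive non-increasing functions $\mathbb R_{>0}\to\mathbb R_{>0}$, the set $\bigcap_k\operatorname{UA}^*_{m,n}(f_k,\boldsymbol{\omega}_k)$ is dense (in $M_{m,n}(\mathbb R)$) and uncountable. (b) For any positive non-increasing $f:\mathbb R_{>0}\to\mathbb R_{>0}$, the set $\bigcap_{\boldsymbol{\omega}\in\mathbb R_{>0}^{m+n}}\operatorname{UA}^*_{m,n}(f,\boldsymbol{\omega})$ is dense and uncountable.
   Context: $M_{m,n}(\mathbb R)$ is the space of real $m\times n$ matrices. For a weight vector $\boldsymbol{\omega}=(\boldsymbol{\alpha},\boldsymbol{\beta})\in\mathbb R_{>0}^{m+n}$ with $\boldsymbol{\alpha}=(\alpha_1,\dots,\alpha_m)$, $\boldsymbol{\beta}=(\beta_1,\dots,\beta_n)$, define quasi-norms $\|\mathbf{x}\|_{\boldsymbol{\alpha}}=\max_i|x_i|^{1/\alpha_i}$ on $\mathbb R^m$ and $\|\mathbf{y}\|_{\boldsymbol{\beta}}=\max_j|y_j|^{1/\beta_j}$ on $\mathbb R^n$. For $f:\mathbb R_{>0}\to\mathbb R_{>0}$, $A\in M_{m,n}(\mathbb R)$ is $(f,\boldsymbol{\omega})$-uniform, written $A\in\operatorname{UA}_{m,n}(f,\boldsymbol{\omega})$, if for every sufficiently large $t$ there exist $\mathbf{q}\in\mathbb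 Z^n\smallsetminus\{0\}$ and $\mathbf{p}\in\mathbb Z^m$ with $\|A\mathbf{q}-\mathbf{p}\|_{\boldsymbol{\alpha}}\le f(t)$ and $\|\mathbf{q}\|_{\boldsymbol{\beta}}\le t$. A matrix is totally irrational if it is not contained in any proper rational affine subspace of $M_{m,n}(\mathbb R)\cong\mathbb R^{mn}$. $\operatorname{UA}^*_{m,n}(f,\boldsymbol{\omega})$ is the set of totally irrational elements of $\operatorname{UA}_{m,n}(f,\boldsymbol{\omega})$. *)

theory Defs
  imports "HOL-Analysis.Analysis"
begin

text \<open>
  Real \<open>m \<times> n\<close> matrices are elements of \<open>real ^ 'n ^ 'm\<close>, with \<open>m = CARD('m)\<close> and
  \<open>n = CARD('n)\<close>, so that \<open>A *v q\<close> lies in \<open>real ^ 'm\<close> for \<open>q\<close> in \<open>real ^ 'n\<close>.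
  A weight vector is a pair of an \<open>'m\<close>-indexed and an \<open>'n\<close>-indexed vector.
\<close>

definition weight_vectors :: "((real ^ 'm) \<times> (real ^ 'n)) set" where
  "weight_vectors = {(\<alpha>, \<beta>). (\<forall>i. 0 < \<alpha> $ i) \<and> (\<forall>j. 0 < \<beta> $ j)}"

definition quasi_norm :: "real ^ 'k \<Rightarrow> real ^ 'k \<Rightarrow> real" where
  "quasi_norm \<alpha> x = Max (range (\<lambda>i. \<bar>x $ i\<bar> powr (1 / \<alpha> $ i)))"

definition real_vec :: "int ^ 'k \<Rightarrow> real ^ 'k" where
  "real_vec q = (\<chi> i. real_of_int (q $ i))"

text \<open>
  Functions from the positive reals to the positive reals are total functions on \<open>real\<close>
  whose values at nonpositive arguments are unconstrained and never matter.
\<close>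

definition pos_nonincreasing :: "(real \<Rightarrow> real) \<Rightarrow> bool" where
  "pos_nonincreasing f \<longleftrightarrow> (\<forall>t>0. 0 < f t) \<and> antimono_on {0<..} f"

definition UA :: "(real \<Rightarrow> real) \<Rightarrow> (real ^ 'm) \<times> (real ^ 'n) \<Rightarrow> (real ^ 'n ^ 'm) set" where
  "UA f \<omega> = {A. \<forall>\<^sub>F t in at_top. \<exists>q p. q \<noteq> 0 \<and>
     quasi_norm (fst \<omega>) (A *v real_vec q - real_vec p) \<le> f t \<and>
     quasi_norm (snd \<omega>) (real_vec q) \<le> t}"

definition rational_matrix :: "real ^ 'n ^ 'm \<Rightarrow> bool" where
  "rational_matrix C \<longleftrightarrow> (\<forall>i j. C $ i $ j \<in> \<rat>)"

text \<open>
  A rational affine subspace is the nonempty solution set of a finite system of linear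
  equations with rational coefficients and rational right-hand sides in the \<open>m n\<close> matrix
  entries; the inner product \<open>C \<bullet> X\<close> on \<open>real ^ 'n ^ 'm\<close> is
  \<open>\<Sum>i\<in>UNIV. \<Sum>j\<in>UNIV. C $ i $ j * X $ i $ j\<close>.
\<close>

definition rational_affine_subspace :: "(real ^ 'n ^ 'm) set \<Rightarrow> bool" where
  "rational_affine_subspace S \<longleftrightarrow> S \<noteq> {} \<and>
     (\<exists>E. finite E \<and> (\<forall>(C, c)\<in>E. rational_matrix C \<and> c \<in> \<rat>) \<and>
          S = {X. \<forall>(C, c)\<in>E. C \<bullet> X = c})"

lemma affine_if_rational_affine_subspace:
  assumes "rational_affine_subspace S"
  shows "affine S"
proof -
  obtain E where S: "S = {X. \<forall>(C, c)\<in>E. C \<bullet> X = c}"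
    using assms unfolding rational_affine_subspace_def by blast
  have "S = (\<Inter>(C, c)\<in>E. {X. C \<bullet> X = c})"
    unfolding S by auto
  then show ?thesis
    by (auto intro!: affine_Inter affine_hyperplane)
qed

definition totally_irrational :: "real ^ 'n ^ 'm \<Rightarrow> bool" where
  "totally_irrational A \<longleftrightarrow> \<not> (\<exists>S. rational_affine_subspace S \<and> S \<noteq> UNIV \<and> A \<in> S)"

definition UA_star :: "(real \<Rightarrow> real) \<Rightarrow> (real ^ 'm) \<times> (real ^ 'n) \<Rightarrow> (real ^ 'n ^ 'm) set" where
  "UA_star f \<omega> = {A \<in> UA f \<omega>. totally_irrational A}"

end

theory Submission
  imports Defs
begin

text \<open>
  Khintchine's construction works here: write \<open>L(q, p) = {A. A q = p}\<close> for integer vectors \<open>q \<noteq> 0\<close> and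
  \<open>p\<close>. As \<open>n \<ge> 2\<close>, each point of \<open>L(q, p)\<close> is arbitrarily close to a point of
  \<open>L(q, p) \<inter> L(q', p')\<close> with \<open>q'\<close> arbitrarily large, and near such a point \<open>\<bar>A q - p\<bar>\<close> is below any
  bound prescribed in terms of \<open>q'\<close>. The direction of \<open>q'\<close> can be chosen such that \<open>L(q', p')\<close> is
  not contained in a given hyperplane, so it is possible to move off that hyperplane inside
  \<open>L(q', p')\<close>. Iterating this inside nested balls gives a matrix with the required uniform
  approximations that avoids any given countable family of real hyperplanes. Avoiding the rational
  ones is total irrationality, and avoiding in addition a hyperplane through each member of a
  countable set gives uncountability. Weights are absorbed into the approximation function.
\<close>

section \<open>Choice of integer directions and orthogonal vectors\<close>

text \<open>The vectors \<open>e_a + k e_b\<close> with \<open>a\<close> and \<open>b\<close>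
  distinct have pairwise different slopes, so each line through 0 contains at most one of them and
  excluding two slopes suffices.\<close>

lemma exists_integer_vector_off_two_lines:
  fixes x y :: "real ^ 'n::finite"
  assumes "CARD('n) \<ge> 2"
  obtains w :: "int ^ 'n" where "w \<noteq> 0" "real_vec w \<notin> span {x}" "real_vec w \<notin> span {y}"
proof -
  obtain a b :: 'n where ab: "a \<noteq> b"
    using assms card_2_iff' [of "UNIV :: 'n set"] card_le_Suc0_iff_eq [of "UNIV :: 'n set"] by force
  have "infinite (range real)"
    by (simp add: range_inj_infinite inj_on_def)
  then have "infinite (range real - {x $ b / x $ a, y $ b / y $ a})"
    by (simp add: Diff_infinite_finite)
  then have "range real - {x $ b / x $ a, y $ b / y $ a} \<noteq> {}"
    by (rule infinite_imp_nonempty)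
  then obtain k :: nat where k: "real k \<noteq> x $ b / x $ a" "real k \<noteq> y $ b / y $ a"
    by auto
  define w :: "int ^ 'n" where "w = (\<chi> i. if i = a then 1 else if i = b then int k else 0)"
  \<comment> \<open>If \<open>z $ a = 0\<close>, the quotient has the default value 0, but then
    \<open>s * z $ a = 1\<close> is already impossible.\<close>
  have off: "real_vec w \<notin> span {z}" if "real k \<noteq> z $ b / z $ a" for z
  proof
    assume "real_vec w \<in> span {z}"
    then obtain s where s: "real_vec w = s *\<^sub>R z"
      by (auto simp: span_singleton)
    have "s * z $ a = 1" "s * z $ b = real k"
      using arg_cong [OF s, of "\<lambda>v. v $ a"] arg_cong [OF s, of "\<lambda>v. v $ b"] ab
      by (simp_all add: w_def real_vec_def)
    then show False
      using that by (metis div_by_1 mult_zero_left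
          nonzero_mult_divide_mult_cancel_left zero_neq_one)
  qed
  have "w $ a = 1"
    by (simp add: w_def)
  then have "w \<noteq> 0"
    by auto
  then show thesis
    using that off k by blast
qed

lemma exists_orthogonal_not_orthogonal:
  fixes x y :: "'a::euclidean_space"
  assumes "y \<notin> span {x}"
  obtains v where "v \<bullet> x = 0" "v \<bullet> y \<noteq> 0"
proof -
  \<comment> \<open>The component of \<open>y\<close> orthogonal to \<open>x\<close>; for
    \<open>x = 0\<close> the quotient is 0 and \<open>v\<close> is \<open>y\<close>.\<close>
  define v where "v = y - ((y \<bullet> x) / (x \<bullet> x)) *\<^sub>R x"
  have vx: "v \<bullet> x = 0"
    by (simp add: v_def inner_diff_left)
  have "v \<noteq> 0"
    using assms by (auto simp: v_def span_singleton)
  moreover have "v \<bullet> y = v \<bullet> v"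
    using vx by (simp add: v_def inner_diff_right)
  ultimately show thesis
    using that vx by auto
qed

section \<open>Rank-one perturbations that preserve a linear relation\<close>

definition outer :: "real ^ 'm \<Rightarrow> real ^ 'n \<Rightarrow> real ^ 'n ^ 'm" where
  "outer u v = (\<chi> i. (u $ i) *\<^sub>R v)"

lemma outer_mult_vec: "outer u v *v x = (v \<bullet> x) *\<^sub>R u"
  by (simp add: outer_def vec_eq_iff matrix_vector_mult_def inner_vec_def sum_distrib_left
      mult_ac)

lemma norm_outer_le:
  fixes u :: "real ^ 'm::finite"
  assumes "\<And>i. \<bar>u $ i\<bar> \<le> r"
  shows "norm (outer u v) \<le> real CARD('m) * (r * norm v)"
proof -
  have "norm (outer u v) \<le> (\<Sum>i\<in>UNIV. norm (outer u v $ i))"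
    unfolding norm_vec_def by (rule L2_set_le_sum) simp
  also have "\<dots> \<le> (\<Sum>i\<in>(UNIV :: 'm set). r * norm v)"
    by (intro sum_mono) (simp add: outer_def assms mult_right_mono)
  finally show ?thesis
    by simp
qed

lemma real_vec_scale: "real_vec (of_int k *s w) = of_int k *\<^sub>R real_vec w"
  by (simp add: real_vec_def vec_eq_iff)

text \<open>Rounding \<open>A (N w)\<close> to an integer vector costs at most 1 per coordinate,
  whatever \<open>N\<close> is. A rank-one correction that acts on the long vector
  \<open>N w\<close> absorbs this with norm \<open>O(1/N)\<close>, and a row direction orthogonal to
  \<open>x\<close> leaves \<open>A x\<close> alone.\<close>

lemma exists_near_matrix_with_second_relation:
  fixes A :: "real ^ 'n::finite ^ 'm::finite" and w :: "int ^ 'n"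
  assumes w: "real_vec w \<notin> span {x}" and e: "0 < e"
  obtains N :: nat and p A' where "0 < N" "K < real N" "A' *v x = A *v x"
    "A' *v real_vec (int N *s w) = real_vec p" "dist A A' < e"
proof -
  obtain v where v: "v \<bullet> x = 0" "v \<bullet> real_vec w \<noteq> 0"
    using exists_orthogonal_not_orthogonal [OF w] .
  define d where "d = v \<bullet> real_vec w"
  define B where "B = real CARD('m) * (inverse \<bar>d\<bar> * norm v)"
  obtain N :: nat where N: "max (max 0 K) (B / e) < real N"
    using reals_Archimedean2 by blast
  then have N0: "0 < N" "K < real N" and "B < e * real N"
    using e by (simp_all add: field_simps)
  define p :: "int ^ 'm" where "p = (\<chi> i. \<lfloor>real N * (A *v real_vec w) $ i\<rfloor>)"
  \<comment> \<open>Solves \<open>N d u = p - N A w\<close>, as \<open>outer u v\<close> maps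
    \<open>N w\<close> to \<open>N d u\<close>.\<close>
  define u where "u = inverse (real N * d) *\<^sub>R (real_vec p - real N *\<^sub>R (A *v real_vec w))"
  have "\<bar>u $ i\<bar> \<le> inverse (real N) * inverse \<bar>d\<bar>" for i
  proof -
    have "\<bar>(real_vec p - real N *\<^sub>R (A *v real_vec w)) $ i\<bar> \<le> 1"
      by (simp add: real_vec_def p_def) linarith
    then have "inverse \<bar>real N * d\<bar> * \<bar>(real_vec p - real N *\<^sub>R (A *v real_vec w)) $ i\<bar>
        \<le> inverse \<bar>real N * d\<bar> * 1"
      by (intro mult_left_mono) auto
    then show ?thesis
      unfolding u_def by (simp add: abs_mult)
  qed
  from norm_outer_le [OF this, of v] have "norm (outer u v) \<le> B / real N"
    by (simp add: B_def field_simps)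
  also have "\<dots> < e"
    using \<open>B < e * real N\<close> N0 by (simp add: field_simps)
  finally have "dist A (A + outer u v) < e"
    by (simp add: dist_norm)
  moreover have "(A + outer u v) *v x = A *v x"
    by (simp add: matrix_vector_mult_add_rdistrib outer_mult_vec v)
  moreover have "(A + outer u v) *v real_vec (int N *s w) = real_vec p"
  proof -
    have "real N *\<^sub>R (d *\<^sub>R u) = real_vec p - real N *\<^sub>R (A *v real_vec w)"
      using v N0 by (simp add: u_def d_def field_simps)
    then show ?thesis
      using real_vec_scale [of "int N" w]
      by (simp add: matrix_vector_mult_add_rdistrib outer_mult_vec d_def
          matrix_vector_mult_scaleR scaleR_add_right)
  qed
  ultimately show thesis
    using that N0 by blast
qed

text \<open>Changing row \<open>i\<close> along a vector orthogonal to \<open>x\<close> but not to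
  \<open>C $ i\<close> fixes \<open>A x\<close> and moves \<open>C \<bullet> A\<close> at a nonzero
  rate, so arbitrarily small changes suffice.\<close>

lemma exists_near_matrix_off_hyperplane:
  fixes A C :: "real ^ 'n::finite ^ 'm::finite"
  assumes "C $ i \<notin> span {x}" and S: "open S" "A \<in> S"
  obtains A' where "A' \<in> S" "A' *v x = A *v x" "C \<bullet> A' \<noteq> c"
proof (cases "C \<bullet> A = c")
  case True
  obtain v where v: "v \<bullet> x = 0" "v \<bullet> C $ i \<noteq> 0"
    using exists_orthogonal_not_orthogonal [OF assms(1)] .
  define D where "D = outer (axis i 1 :: real ^ 'm) v"
  have "C \<bullet> D = (\<Sum>k\<in>UNIV. if k = i then C $ k \<bullet> v else 0)"
    unfolding inner_vec_def [of C] by (intro sum.cong) (simp_all add: D_def outer_def axis_def)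
  then have CD: "C \<bullet> D \<noteq> 0"
    using v by (simp add: inner_commute)
  have "((\<lambda>s::real. A + s *\<^sub>R D) \<longlongrightarrow> A + 0 *\<^sub>R D) (at_right 0)"
    by (intro tendsto_intros)
  then have "\<forall>\<^sub>F s in at_right 0. A + s *\<^sub>R D \<in> S"
    using S by (simp add: topological_tendstoD)
  moreover have "\<forall>\<^sub>F s in at_right (0::real). 0 < s"
    by (rule eventually_at_right_less)
  ultimately have "\<forall>\<^sub>F s in at_right 0. 0 < s \<and> A + s *\<^sub>R D \<in> S"
    by (rule eventually_conj [rotated])
  then obtain s where s: "0 < s" "A + s *\<^sub>R D \<in> S"
    by (metis (mono_tags, lifting) eventually_happens trivial_limit_at_right_real)
  have "(A + s *\<^sub>R D) *v x = A *v x"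
    by (simp add: matrix_vector_mult_add_rdistrib scaleR_matrix_vector_assoc [symmetric] D_def outer_mult_vec v)
  moreover have "C \<bullet> (A + s *\<^sub>R D) \<noteq> c"
    using CD s True by (simp add: inner_add_right)
  ultimately show thesis
    using that s by blast
next
  case False
  then show thesis
    using that S by blast
qed

text \<open>The case \<open>q = 0\<close>, \<open>p = 0\<close> is allowed: it starts the iteration at an arbitrary matrix.\<close>

lemma approximation_step:
  fixes A C :: "real ^ 'n::finite ^ 'm::finite"
  assumes n2: "CARD('n) \<ge> 2" and Aq: "A *v real_vec q = real_vec p" and e: "0 < e"
    and C: "C \<noteq> 0" and h: "\<And>t::real. 0 < t \<Longrightarrow> 0 < h t"
  obtains q' p' A' e' where "q' \<noteq> 0" "K < norm (real_vec q')" "A' *v real_vec q' = real_vec p'"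
    "0 < e'" "cball A' e' \<subseteq> cball A e"
    "\<forall>X\<in>cball A' e'. norm (X *v real_vec q - real_vec p) < h (norm (real_vec q')) \<and> C \<bullet> X \<noteq> c"
proof -
  obtain i where i: "C $ i \<noteq> 0"
    using C by (metis vec_eq_iff zero_index)
  obtain w :: "int ^ 'n" where w: "w \<noteq> 0" "real_vec w \<notin> span {real_vec q}"
      "real_vec w \<notin> span {C $ i}"
    using exists_integer_vector_off_two_lines [OF n2] .
  obtain N p' A1 where N: "0 < N" "K < real N" and A1: "A1 *v real_vec q = A *v real_vec q"
      "A1 *v real_vec (int N *s w) = real_vec p'" "dist A A1 < e"
    using exists_near_matrix_with_second_relation [OF w(2) e] .
  define q' where "q' = int N *s w"
  have q'_eq: "real_vec q' = real N *\<^sub>R real_vec w"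
    using real_vec_scale [of "int N" w] by (simp add: q'_def)
  obtain j where j: "w $ j \<noteq> 0"
    using w by (metis vec_eq_iff zero_index)
  \<comment> \<open>A nonzero integer entry has modulus at least 1, so \<open>N w\<close> has norm
    at least \<open>N\<close>, which exceeds \<open>K\<close>.\<close>
  have "1 \<le> \<bar>real_vec w $ j\<bar>"
    using j by (simp add: real_vec_def)
  also have "\<dots> \<le> norm (real_vec w)"
    by (rule component_le_norm_cart)
  finally have nq': "real N \<le> norm (real_vec q')"
    using N by (simp add: q'_eq)
  have "q' $ j \<noteq> 0"
    using j N by (simp add: q'_def)
  then have q'0: "q' \<noteq> 0"
    by auto
  \<comment> \<open>As \<open>q'\<close> is a nonzero multiple of \<open>w\<close> and
    \<open>C $ i\<close> is nonzero, dependence would put \<open>w\<close> on the excluded line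
    through \<open>C $ i\<close>.\<close>
  have Ci: "C $ i \<notin> span {real_vec q'}"
  proof
    assume "C $ i \<in> span {real_vec q'}"
    then obtain s where s: "C $ i = s *\<^sub>R real N *\<^sub>R real_vec w"
      by (auto simp: span_singleton q'_eq)
    then have "s \<noteq> 0"
      using i by auto
    then have "real_vec w = inverse (s * real N) *\<^sub>R (C $ i)"
      using N unfolding s scaleR_scaleR by (simp add: field_simps)
    then show False
      using w(3) by (metis span_base span_mul singletonI)
  qed
  define S where "S = ball A e \<inter> {X. norm (X *v real_vec q - real_vec p) < h (norm (real_vec q'))}"
  have cont: "continuous_on UNIV (\<lambda>X :: real ^ 'n ^ 'm. norm (X *v real_vec q - real_vec p))"
    unfolding matrix_vector_mult_def by (intro continuous_intros)
  have "open S"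
    unfolding S_def by (intro open_Int open_ball open_Collect_less cont continuous_intros)
  \<comment> \<open>The relation for \<open>q\<close> still holds exactly at \<open>A1\<close>, so
    the error is 0 and any positive bound is met, even one that depends on the later vector
    \<open>q'\<close>.\<close>
  moreover have "A1 \<in> S"
    using A1 Aq h [of "norm (real_vec q')"] N nq' by (simp add: S_def del: zero_less_norm_iff)
  ultimately obtain A2 where A2: "A2 \<in> S" "A2 *v real_vec q' = A1 *v real_vec q'" "C \<bullet> A2 \<noteq> c"
    using exists_near_matrix_off_hyperplane [OF Ci] by blast
  have "open (S \<inter> {X. C \<bullet> X \<noteq> c})"
    using \<open>open S\<close> by (intro open_Int open_Collect_neq continuous_intros)
  then obtain e' where e': "0 < e'" "cball A2 e' \<subseteq> S \<inter> {X. C \<bullet> X \<noteq> c}"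
    using A2 unfolding open_contains_cball by blast
  show thesis
  proof
    show "q' \<noteq> 0" "K < norm (real_vec q')" "0 < e'" "A2 *v real_vec q' = real_vec p'"
      using q'0 N nq' e' A2 A1 by (simp_all add: q'_def)
    show "cball A2 e' \<subseteq> cball A e"
      using e' by (auto simp: S_def)
  qed (use e' in \<open>auto simp: S_def\<close>)
qed

section \<open>Iteration in nested balls\<close>

lemma pos_nonincreasingD:
  assumes "pos_nonincreasing f" "0 < s" "s \<le> t"
  shows "f t \<le> f s"
  using assms by (simp add: pos_nonincreasing_def monotone_on_def)

text \<open>The weight-free counterpart of \<open>UA\<close>, with Euclidean norms on both sides;
  the weights enter only through the choice of \<open>g\<close>.\<close>

definition uniformly_approximable :: "(real \<Rightarrow> real) \<Rightarrow> real ^ 'n ^ 'm \<Rightarrow> bool" where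
  "uniformly_approximable g A \<longleftrightarrow> (\<forall>\<^sub>F t in at_top. \<exists>q p. q \<noteq> 0 \<and>
     norm (A *v real_vec q - real_vec p) \<le> g t \<and> norm (real_vec q) \<le> t)"

text \<open>The vector \<open>q n\<close> serves all \<open>t\<close> from \<open>norm (q n)\<close>
  up to \<open>norm (q (Suc n))\<close>, since its error is below the bound at the upper end. Stage
  \<open>n\<close> treats only \<open>g 0, ..., g n\<close>, which suffices because approximability
  concerns large \<open>t\<close> only.\<close>

lemma exists_uniformly_approximable_off_hyperplanes:
  fixes A :: "real ^ 'n::finite ^ 'm::finite"
  assumes n2: "CARD('n) \<ge> 2" and g: "\<And>k::nat. pos_nonincreasing (g k)" and e: "0 < e"
    and Z: "countable Z" "0 \<notin> fst ` Z"
  obtains X where "X \<in> cball A e" "\<And>C c. (C, c) \<in> Z \<Longrightarrow> C \<bullet> X \<noteq> (c::real)"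
    "\<And>k. uniformly_approximable (g k) X"
proof -
  \<comment> \<open>The extra hyperplane makes the family nonempty, hence enumerable by a
    sequence.\<close>
  define Z' where "Z' = insert (1, 0) Z"
  have Z': "countable Z'" "Z' \<noteq> {}" "0 \<notin> fst ` Z'"
    using Z by (auto simp: Z'_def vec_eq_iff)
  define z where "z = from_nat_into Z'"
  have range_z: "range z = Z'"
    unfolding z_def by (rule range_from_nat_into [OF Z'(2,1)])
  define P where "P n = (\<lambda>(q, p, Y, r). Y *v real_vec q = real_vec p \<and> 0 < r \<and>
      (n = 0 \<longrightarrow> (Y, r) = (A, e)))" for n :: nat
  \<comment> \<open>Growth by more than 1 per stage forces the norms of the \<open>q n\<close> to
    infinity. The start may be 0, but every later vector is nonzero.\<close>
  define Q where "Q n = (\<lambda>(q, p :: int ^ 'm, Y, r) (q' :: int ^ 'n, p' :: int ^ 'm, Y', r'). q' \<noteq> 0 \<and>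
      norm (real_vec q) + 1 < norm (real_vec q') \<and> cball Y' r' \<subseteq> cball Y r \<and>
      (\<forall>X\<in>cball Y' r'. (\<forall>k\<le>n. norm (X *v real_vec q - real_vec p) < g k (norm (real_vec q'))) \<and>
        fst (z n) \<bullet> X \<noteq> snd (z n)))"
    for n
  have "\<exists>F. \<forall>n. P n (F n) \<and> Q n (F n) (F (Suc n))"
  proof (rule dependent_nat_choice)
    have "P 0 (0, 0, A, e)"
      using e by (simp add: P_def real_vec_def matrix_vector_mult_def vec_eq_iff)
    then show "\<exists>x. P 0 x" ..
  next
    fix x n
    assume "P n x"
    then obtain q p Y r where x: "x = (q, p, Y, r)" and Y: "Y *v real_vec q = real_vec p" "0 < r"
      by (cases x) (auto simp: P_def)
    \<comment> \<open>A minimum of finitely many positive values, so one step handles all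
      \<open>k \<le> n\<close> at once.\<close>
    define h where "h t = Min ((\<lambda>k. g k t) ` {..n})" for t
    have h: "0 < h t" if "0 < t" for t
      using g that by (auto simp: h_def pos_nonincreasing_def)
    have zn: "fst (z n) \<noteq> 0"
      using Z'(3) unfolding range_z [symmetric] by (metis imageI rangeI)
    obtain q' p' Y' r' where *: "q' \<noteq> 0" "norm (real_vec q) + 1 < norm (real_vec q')"
        "Y' *v real_vec q' = real_vec p'" "0 < r'" "cball Y' r' \<subseteq> cball Y r"
        "\<forall>X\<in>cball Y' r'. norm (X *v real_vec q - real_vec p) < h (norm (real_vec q')) \<and>
          fst (z n) \<bullet> X \<noteq> snd (z n)"
      by (rule approximation_step [where h = h and K = "norm (real_vec q) + 1" and c = "snd (z n)",
          OF n2 Y zn h]) blast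
    have "norm (X *v real_vec q - real_vec p) < g k (norm (real_vec q'))"
      if "X \<in> cball Y' r'" "k \<le> n" for X k
      using bspec [OF *(6) that(1)] that(2) by (auto simp: h_def)
    with * have "P (Suc n) (q', p', Y', r') \<and> Q n x (q', p', Y', r')"
      unfolding P_def Q_def x by simp
    then show "\<exists>y. P (Suc n) y \<and> Q n x y" ..
  qed
  then obtain F where F: "\<And>n. P n (F n)" "\<And>n. Q n (F n) (F (Suc n))"
    by blast
  obtain q p Y r where FE: "\<And>n. F n = (q n, p n, Y n, r n)"
    using that [of "fst \<circ> F" "fst \<circ> snd \<circ> F" "fst \<circ> snd \<circ> snd \<circ> F" "snd \<circ> snd \<circ> snd \<circ> F"]
    by simp
  have YA: "Y 0 = A" "r 0 = e" and r: "0 < r n"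
    and q0: "q (Suc n) \<noteq> 0" and q_gt: "norm (real_vec (q n)) + 1 < norm (real_vec (q (Suc n)))"
    and sub: "cball (Y (Suc n)) (r (Suc n)) \<subseteq> cball (Y n) (r n)"
    and small: "\<And>X k. X \<in> cball (Y (Suc n)) (r (Suc n)) \<Longrightarrow> k \<le> n \<Longrightarrow>
        norm (X *v real_vec (q n) - real_vec (p n)) < g k (norm (real_vec (q (Suc n))))"
    and off: "\<And>X. X \<in> cball (Y (Suc n)) (r (Suc n)) \<Longrightarrow> fst (z n) \<bullet> X \<noteq> snd (z n)" for n
    using F(1) [of 0] F(1) [of n] F(2) [of n] by (auto simp: P_def Q_def FE)
  have "cball (Y n) (r n) \<subseteq> cball (Y m) (r m)" if "m \<le> n" for m n
    using lift_Suc_antimono_le [of "\<lambda>n. cball (Y n) (r n)", OF sub that] .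
  then obtain X where X: "\<And>n. X \<in> cball (Y n) (r n)"
    using bounded_closed_nest [of "\<lambda>n. cball (Y n) (r n)"] r
    by (metis bounded_cball cball_eq_empty closed_cball less_asym)
  have q_ge: "real n \<le> norm (real_vec (q n))" for n
  proof (induction n)
    case (Suc n)
    then show ?case
      using q_gt [of n] by simp
  qed simp
  show thesis
  proof
    show "X \<in> cball A e"
      using X [of 0] by (simp add: YA)
    show "C \<bullet> X \<noteq> c" if "(C, c) \<in> Z" for C c
    proof -
      have "(C, c) \<in> range z"
        using that by (simp add: range_z Z'_def)
      then obtain n where "z n = (C, c)"
        by auto
      then show ?thesis
        using off [OF X, of n] by simp
    qed
    show "uniformly_approximable (g k) X" for k
      unfolding uniformly_approximable_def eventually_at_top_linorder
    proof (intro exI [of _ "norm (real_vec (q (Suc k)))"] allI impI)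
      fix t
      assume t: "norm (real_vec (q (Suc k))) \<le> t"
      \<comment> \<open>The first vector longer than \<open>t\<close>; its predecessor, with index
        \<open>i\<close>, is the approximating one.\<close>
      define n where "n = (LEAST n. t < norm (real_vec (q n)))"
      obtain n0 where "t < real n0"
        using reals_Archimedean2 by blast
      then have "t < norm (real_vec (q n0))"
        using q_ge [of n0] by linarith
      then have n: "t < norm (real_vec (q n))" "\<And>i. i < n \<Longrightarrow> norm (real_vec (q i)) \<le> t"
        unfolding n_def by (fact LeastI, use not_less_Least in force)
      have "strict_mono (\<lambda>n. norm (real_vec (q n)))"
        unfolding strict_mono_Suc_iff using q_gt by (smt (verit))
      \<comment> \<open>Hence \<open>i\<close> is at least \<open>k\<close>, so that
        \<open>g k\<close> was treated at stage \<open>i\<close>, and at least 1, so that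
        \<open>q i\<close> is not the possibly zero start.\<close>
      then have "Suc k < n"
        using t n(1) by (metis (no_types, lifting) le_less_trans strict_mono_less)
      then obtain i where i: "n = Suc i" "Suc k \<le> i"
        by (cases n) auto
      obtain j where j: "i = Suc j"
        using i(2) by (cases i) auto
      have "norm (X *v real_vec (q i) - real_vec (p i)) < g k (norm (real_vec (q n)))"
        using small [OF X, of k i] i by simp
      also have "\<dots> \<le> g k t"
      proof -
        have "0 < t"
          using q_ge [of "Suc k"] t by simp
        then show ?thesis
          using pos_nonincreasingD [OF g] n(1) by simp
      qed
      finally show "\<exists>q p. q \<noteq> 0 \<and> norm (X *v real_vec q - real_vec p) \<le> g k t \<and> norm (real_vec q) \<le> t"
        using q0 [of j] n(2) [of i] i(1) j by (intro exI [of _ "q i"] exI [of _ "p i"]) simp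
    qed
  qed
qed

section \<open>Total irrationality, density and uncountability\<close>

text \<open>A proper rational affine subspace satisfies some rational equation that fails somewhere,
  so it lies in a single rational hyperplane.\<close>

lemma totally_irrational_if_off_rational_hyperplanes:
  assumes "\<And>C c. rational_matrix C \<Longrightarrow> C \<noteq> 0 \<Longrightarrow> c \<in> \<rat> \<Longrightarrow> C \<bullet> A \<noteq> c"
  shows "totally_irrational A"
  unfolding totally_irrational_def
proof (intro notI, elim exE conjE)
  fix S
  assume "rational_affine_subspace S" and S: "S \<noteq> UNIV" "A \<in> S"
  then obtain E where E: "\<forall>(C, c)\<in>E. rational_matrix C \<and> c \<in> \<rat>"
      and SE: "S = {X. \<forall>(C, c)\<in>E. C \<bullet> X = c}"
    unfolding rational_affine_subspace_def by (elim conjE exE) (rule that)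
  obtain C c X where C: "(C, c) \<in> E" "C \<bullet> X \<noteq> c"
    using S(1) SE by blast
  have "\<forall>(C, c)\<in>E. C \<bullet> A = c"
    using S(2) unfolding SE by simp
  from bspec [OF this C(1)] have "C \<bullet> A = c"
    by simp
  \<comment> \<open>With \<open>C = 0\<close>, the equation at \<open>A\<close> would give
    \<open>c = 0\<close> and the equation would hold at \<open>X\<close> too.\<close>
  moreover from this C have "C \<noteq> 0"
    by auto
  ultimately show False
    using E C assms by blast
qed

lemma countable_rational_matrices:
  "countable {C :: real ^ 'n::finite ^ 'm::finite. rational_matrix C}"
proof (rule countable_subset)
  show "countable (range (\<lambda>r :: 'm \<Rightarrow> 'n \<Rightarrow> rat. (\<chi> i j. of_rat (r i j)) :: real ^ 'n ^ 'm))"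
    by simp
  show "{C :: real ^ 'n ^ 'm. rational_matrix C}
      \<subseteq> range (\<lambda>r :: 'm \<Rightarrow> 'n \<Rightarrow> rat. (\<chi> i j. of_rat (r i j)) :: real ^ 'n ^ 'm)"
  proof
    fix C :: "real ^ 'n ^ 'm"
    assume "C \<in> {C. rational_matrix C}"
    then have "\<forall>i j. \<exists>r. C $ i $ j = of_rat r"
      by (auto simp: rational_matrix_def Rats_def)
    then obtain r where "\<And>i j. C $ i $ j = of_rat (r i j)"
      by metis
    then have "C = (\<chi> i j. of_rat (r i j))"
      by (simp add: vec_eq_iff)
    then show "C \<in> range (\<lambda>r. \<chi> i j. of_rat (r i j))"
      by blast
  qed
qed

lemma dense_uncountable_uniformly_approximable:
  assumes n2: "CARD('n::finite) \<ge> 2" and g: "\<And>k::nat. pos_nonincreasing (g k)"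
  defines "G \<equiv> {X :: real ^ 'n ^ 'm::finite.
    totally_irrational X \<and> (\<forall>k. uniformly_approximable (g k) X)}"
  shows "closure G = UNIV" "uncountable G"
proof -
  define R where "R = {(C :: real ^ 'n ^ 'm, c :: real). rational_matrix C \<and> C \<noteq> 0 \<and> c \<in> \<rat>}"
  have "R \<subseteq> {C. rational_matrix C} \<times> \<rat>"
    by (auto simp: R_def)
  then have R: "countable R"
    by (rule countable_subset) (intro countable_SIGMA countable_rational_matrices countable_rat)
  have ex: "\<exists>X\<in>G. X \<in> cball A e \<and> (\<forall>(C, c)\<in>Z. C \<bullet> X \<noteq> c)"
    if e: "0 < e" and Z: "countable Z" "0 \<notin> fst ` Z" for A e Z
  proof -
    have RZ: "countable (R \<union> Z)" "0 \<notin> fst ` (R \<union> Z)"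
      using R Z by (auto simp: R_def)
    obtain X where X: "X \<in> cball A e" "\<And>C c. (C, c) \<in> R \<union> Z \<Longrightarrow> C \<bullet> X \<noteq> c"
        "\<And>k. uniformly_approximable (g k) X"
      using exists_uniformly_approximable_off_hyperplanes
        [where g = g and A = A, OF n2 g e RZ] by blast
    have "totally_irrational X"
      by (rule totally_irrational_if_off_rational_hyperplanes) (use X(2) in \<open>auto simp: R_def\<close>)
    with X show ?thesis
      by (auto simp: G_def)
  qed
  show "closure G = UNIV"
    using ex [where Z = "{}"] by (auto simp: closure_approachable_le dist_commute)
  show "uncountable G"
  proof
    assume "countable G"
    \<comment> \<open>Any nonzero normal would do; here it is the all-ones matrix. The parallel
      hyperplanes through the points of a countable \<open>G\<close> could all be avoided by a point
      of \<open>G\<close>, which lies on its own hyperplane.\<close>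
    define C :: "real ^ 'n ^ 'm" where "C = 1"
    have "C \<noteq> 0"
      by (simp add: C_def vec_eq_iff)
    then have "0 \<notin> fst ` (\<lambda>X. (C, C \<bullet> X)) ` G"
      by auto
    moreover have "countable ((\<lambda>X. (C, C \<bullet> X)) ` G)"
      using \<open>countable G\<close> by simp
    ultimately show False
      using ex [of 1 "(\<lambda>X. (C, C \<bullet> X)) ` G"] by auto
  qed
qed

section \<open>Absorption of the weights\<close>

text \<open>The outer power serves \<open>\<alpha>\<close>: for \<open>0 < F \<le> 1\<close> and
  \<open>\<alpha> $ i \<le> N\<close>, a coordinate of modulus at most \<open>F ^ N\<close> has
  \<open>1 / \<alpha> $ i\<close>-th power at most \<open>F\<close>. The inner power serves
  \<open>\<beta>\<close>: coordinates of modulus at most \<open>s\<close>, where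
  \<open>s \<ge> 1\<close>, have \<open>1 / \<beta> $ j\<close>-th power at most
  \<open>s ^ N\<close>.\<close>

definition weighted_bound :: "(real \<Rightarrow> real) \<Rightarrow> nat \<Rightarrow> real \<Rightarrow> real" where
  "weighted_bound f N t = (min 1 (f (t ^ N))) ^ N"

lemma pos_nonincreasing_weighted_bound:
  assumes "pos_nonincreasing f"
  shows "pos_nonincreasing (weighted_bound f N)"
proof -
  have pos: "\<And>t. 0 < t \<Longrightarrow> 0 < f t"
    using assms by (simp add: pos_nonincreasing_def)
  have "weighted_bound f N t \<le> weighted_bound f N s" if "0 < s" "s \<le> t" for s t
  proof -
    have "f (t ^ N) \<le> f (s ^ N)" "0 < f (t ^ N)"
      using that by (auto intro!: pos_nonincreasingD [OF assms] pos power_mono)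
    then show ?thesis
      unfolding weighted_bound_def by (intro power_mono) auto
  qed
  then show ?thesis
    using pos by (auto simp: pos_nonincreasing_def monotone_on_def weighted_bound_def)
qed

lemma quasi_norm_le_iff:
  fixes x :: "real ^ 'k::finite"
  shows "quasi_norm \<alpha> x \<le> r \<longleftrightarrow> (\<forall>i. \<bar>x $ i\<bar> powr (1 / \<alpha> $ i) \<le> r)"
  by (auto simp: quasi_norm_def)

lemma UA_if_uniformly_approximable:
  fixes A :: "real ^ 'n::finite ^ 'm::finite"
  assumes f: "pos_nonincreasing f" and \<omega>: "(\<alpha>, \<beta>) \<in> weight_vectors" and N0: "0 < N"
    and \<alpha>: "\<And>i. \<alpha> $ i \<le> real N" and \<beta>: "\<And>j. 1 / \<beta> $ j \<le> real N"
    and A: "uniformly_approximable (weighted_bound f N) A"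
  shows "A \<in> UA f (\<alpha>, \<beta>)"
proof -
  obtain T where T: "\<And>t. T \<le> t \<Longrightarrow> \<exists>q p. q \<noteq> 0 \<and>
      norm (A *v real_vec q - real_vec p) \<le> weighted_bound f N t \<and> norm (real_vec q) \<le> t"
    using A by (auto simp: uniformly_approximable_def eventually_at_top_linorder)
  have "\<exists>q p. q \<noteq> 0 \<and> quasi_norm \<alpha> (A *v real_vec q - real_vec p) \<le> f t \<and>
      quasi_norm \<beta> (real_vec q) \<le> t" if t: "max 1 T ^ N \<le> t" for t
  proof -
    \<comment> \<open>The unweighted approximation is used at the scale \<open>s\<close> with
      \<open>s ^ N = t\<close>; the threshold on \<open>t\<close> ensures both
      \<open>s \<ge> 1\<close> and \<open>s \<ge> T\<close>.\<close>
    define s where "s = root N t"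
    have "1 \<le> max 1 T ^ N"
      by simp
    with t have t1: "1 \<le> t"
      by linarith
    then have sN: "s ^ N = t"
      using N0 by (simp add: s_def)
    have "root N (max 1 T ^ N) \<le> s"
      using t N0 by (simp add: s_def)
    then have s: "1 \<le> s" "T \<le> s"
      using N0 by (simp_all add: real_root_power_cancel)
    obtain q p where q: "q \<noteq> 0" and p: "norm (A *v real_vec q - real_vec p) \<le> weighted_bound f N s"
        and qs: "norm (real_vec q) \<le> s"
      using T [OF s(2)] by blast
    define F where "F = min 1 (f t)"
    have F: "0 < F" "F \<le> 1" "F \<le> f t"
      using f t1 by (auto simp: F_def pos_nonincreasing_def)
    have "\<bar>(A *v real_vec q - real_vec p) $ i\<bar> powr (1 / \<alpha> $ i) \<le> f t" for i
    proof -
      have \<alpha>0: "0 < \<alpha> $ i"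
        using \<omega> by (simp add: weight_vectors_def)
      have "\<bar>(A *v real_vec q - real_vec p) $ i\<bar> \<le> F ^ N"
        using component_le_norm_cart [of "A *v real_vec q - real_vec p" i] p
        by (simp add: weighted_bound_def sN F_def)
      then have "\<bar>(A *v real_vec q - real_vec p) $ i\<bar> powr (1 / \<alpha> $ i) \<le> (F ^ N) powr (1 / \<alpha> $ i)"
        using \<alpha>0 by (intro powr_mono2) auto
      also have "\<dots> = F powr (real N / \<alpha> $ i)"
        using F by (simp add: powr_realpow [symmetric] powr_powr)
      \<comment> \<open>The base is at most 1 and the exponent at least 1.\<close>
      also have "\<dots> \<le> F powr 1"
        using F \<alpha> [of i] \<alpha>0 by (intro powr_mono') auto
      finally show ?thesis
        using F by simp
    qed
    moreover have "\<bar>real_vec q $ j\<bar> powr (1 / \<beta> $ j) \<le> t" for j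
    proof -
      have "0 < \<beta> $ j"
        using \<omega> by (simp add: weight_vectors_def)
      then have "\<bar>real_vec q $ j\<bar> powr (1 / \<beta> $ j) \<le> s powr (1 / \<beta> $ j)"
        using component_le_norm_cart [of "real_vec q" j] qs by (intro powr_mono2) auto
      also have "\<dots> \<le> s powr real N"
        using s \<beta> by (intro powr_mono) auto
      finally show ?thesis
        using s sN by (simp add: powr_realpow)
    qed
    ultimately show ?thesis
      using q by (auto simp: quasi_norm_le_iff)
  qed
  then show ?thesis
    unfolding UA_def by (auto simp: eventually_at_top_linorder)
qed

text \<open>Every weight vector is governed by some positive integer, which reduces the uncountable
  family of all weights to countably many bounds.\<close>

lemma exists_weight_bound:
  fixes \<alpha> :: "real ^ 'm::finite" and \<beta> :: "real ^ 'n::finite"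
  shows "\<exists>k. (\<forall>i. \<alpha> $ i \<le> real (Suc k)) \<and> (\<forall>j. 1 / \<beta> $ j \<le> real (Suc k))"
proof -
  define B where "B = Max (range (\<lambda>i. \<alpha> $ i) \<union> range (\<lambda>j. 1 / \<beta> $ j))"
  obtain k where "B < real k"
    using reals_Archimedean2 by blast
  moreover have "\<alpha> $ i \<le> B" "1 / \<beta> $ j \<le> B" for i j
    unfolding B_def by (auto intro!: Max_ge)
  ultimately show ?thesis
    by (intro exI [of _ k]) (force intro: order_trans)
qed

section \<open>Conclusion for sequences of weights and for all weights\<close>

lemma closure_uncountable_mono:
  assumes "closure S = UNIV" "uncountable S" "S \<subseteq> T"
  shows "closure T = UNIV \<and> uncountable T"
  using closure_mono [OF assms(3)] countable_subset [OF assms(3)] assms(1,2) by auto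

theorem theorem1p7:
  assumes "CARD('n::finite) \<ge> 2"
  shows "(\<forall>(\<omega> :: nat \<Rightarrow> (real ^ 'm::finite) \<times> (real ^ 'n)) (f :: nat \<Rightarrow> real \<Rightarrow> real).
            (\<forall>k. \<omega> k \<in> weight_vectors) \<longrightarrow> (\<forall>k. pos_nonincreasing (f k)) \<longrightarrow>
            closure (\<Inter>k. UA_star (f k) (\<omega> k)) = UNIV \<and>
            uncountable (\<Inter>k. UA_star (f k) (\<omega> k)))
       \<and> (\<forall>f :: real \<Rightarrow> real. pos_nonincreasing f \<longrightarrow>
            closure (\<Inter>\<omega> \<in> (weight_vectors :: ((real ^ 'm) \<times> (real ^ 'n)) set). UA_star f \<omega>) = UNIV \<and>
            uncountable (\<Inter>\<omega> \<in> (weight_vectors :: ((real ^ 'm) \<times> (real ^ 'n)) set). UA_star f \<omega>))"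
proof (intro conjI [of "All _"] allI impI)
  fix \<omega> :: "nat \<Rightarrow> (real ^ 'm) \<times> (real ^ 'n)" and f :: "nat \<Rightarrow> real \<Rightarrow> real"
  assume \<omega>: "\<forall>k. \<omega> k \<in> weight_vectors" and f: "\<forall>k. pos_nonincreasing (f k)"
  obtain N where N: "\<And>k i. fst (\<omega> k) $ i \<le> real (Suc (N k))"
      "\<And>k j. 1 / snd (\<omega> k) $ j \<le> real (Suc (N k))"
    using exists_weight_bound [of "fst (\<omega> k)" "snd (\<omega> k)" for k] by metis
  let ?g = "\<lambda>k. weighted_bound (f k) (Suc (N k))"
  show "closure (\<Inter>k. UA_star (f k) (\<omega> k)) = UNIV \<and> uncountable (\<Inter>k. UA_star (f k) (\<omega> k))"
  proof (rule closure_uncountable_mono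
      [OF dense_uncountable_uniformly_approximable [OF assms, where g = ?g]])
    have "X \<in> UA (f k) (\<omega> k)" if "uniformly_approximable (?g k) X" for X k
      using UA_if_uniformly_approximable [of "f k" "fst (\<omega> k)" "snd (\<omega> k)" "Suc (N k)"] that \<omega> f N
      by simp
    then show "{X. totally_irrational X \<and> (\<forall>k. uniformly_approximable (?g k) X)}
        \<subseteq> (\<Inter>k. UA_star (f k) (\<omega> k))"
      by (auto simp: UA_star_def)
  qed (use f pos_nonincreasing_weighted_bound in blast)+
next
  fix f :: "real \<Rightarrow> real"
  assume f: "pos_nonincreasing f"
  \<comment> \<open>One bound per possible integer: a matrix approximable for all of them lies in
    \<open>UA f \<omega>\<close> for every weight vector at once.\<close>
  let ?g = "\<lambda>k. weighted_bound f (Suc k)"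
  let ?W = "weight_vectors :: ((real ^ 'm) \<times> (real ^ 'n)) set"
  show "closure (\<Inter>\<omega>\<in>?W. UA_star f \<omega>) = UNIV \<and> uncountable (\<Inter>\<omega>\<in>?W. UA_star f \<omega>)"
  proof (rule closure_uncountable_mono
      [OF dense_uncountable_uniformly_approximable [OF assms, where g = ?g]])
    have "X \<in> UA f \<omega>" if "\<And>k. uniformly_approximable (?g k) X" "\<omega> \<in> ?W" for X \<omega>
    proof -
      obtain k where "\<And>i. fst \<omega> $ i \<le> real (Suc k)" "\<And>j. 1 / snd \<omega> $ j \<le> real (Suc k)"
        using exists_weight_bound [of "fst \<omega>" "snd \<omega>"] by blast
      then show ?thesis
        using UA_if_uniformly_approximable [of f "fst \<omega>" "snd \<omega>" "Suc k"] that f by simp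
    qed
    then show "{X. totally_irrational X \<and> (\<forall>k. uniformly_approximable (?g k) X)}
        \<subseteq> (\<Inter>\<omega>\<in>?W. UA_star f \<omega>)"
      by (auto simp: UA_star_def)
  qed (use f pos_nonincreasing_weighted_bound in blast)+
qed

end
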